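(* Let $\mathcal{F}$ be a forbidden family and let $k,d\in\mathbb{N}$. Let $G_1,G_2,\dots,G_d$ be graphs, each with $\mathcal{F}$-free chromatic number $\chi(G_i,\mathcal{F})\leq k+1$. Then $$\chi(G_1\,\square\,G_2\,\square\cdots\square\,G_d,\mathcal{F})\leq 2k(kd-k+1)+1.$$ Moreover, for all $\epsilon>0$ and for large $d>d(k,\epsilon)$, $$\chi(G_1\,\square\,G_2\,\square\cdots\square\,G_d,\mathcal{F})\leq 1+\frac{2e^{\gamma}}{1-\epsilon}\,dk\log k.$$
   Context: All graphs are finite, simple and undirected. $\mathbb{N}=\{1,2,\dots\}$, $\gamma=0.5772\ldots$ is Euler's constant, and $\log$ is the natural logarithm. A colouring of a graph $G$ is a function $c:V(G)\to\mathbb{Z}$ with $c(v)\neq c(w)$ for every edge $vw\in E(G)$; it is a $k$-colouring if it takes at most $k$ distinct values. A forbidden family $\mathcal{F}$ is a family of connected bipartite graphs, each with at least three vertices. A colouring $c$ of $G$ is $\mathcal{F}$-free if $|\{c(v):v\in V(H)\}|\geq 3$ for every subgraph $H$ of $G$ that is isomorphic to a graph in $\mathcal{F}$. The $\mathcal{F}$-free chromatic number $\chi(G,\mathcal{F})$ is the minimum integer $k$ such that $G$ has an $\mathcal{F}$-free $k$-colouring. The cartesian product $G_1\,\square\,G_2\,\square\cdots\square\,G_d$ has vertex set $V(G_1)\times\cdots\times V(G_d)$, where $(v_1,\dots,v_d)$ and $(w_1,\dots,w_d)$ are adjacent if and only if $v_iw_i\in E(G_i)$ for some $i$ and $v_j=w_j$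 for all $j\neq i$. Here $d(k,\epsilon)$ denotes a threshold depending on $k$ and $\epsilon$.
   Formalization: The second bound is stated for k ≥ 2 and 0 < ε < 1: for k = 1, log k = 0 and the bound 1 fails for G_i = K_2; for ε = 1 it is undefined, and for ε > 1 it is negative for large d. *)

theory Defs
  imports "HOL-Analysis.Analysis" "Graph_Theory.Graph_Theory"
begin

text \<open>
  A finite simple undirected graph is a \<^locale>\<open>pair_graph\<close>: every edge \<open>vw\<close> is
  present as both arcs \<open>(v, w)\<close> and \<open>(w, v)\<close>.
\<close>

definition bipartite :: "'a pair_pre_digraph \<Rightarrow> bool" where
  "bipartite G \<longleftrightarrow> (\<exists>A B. pverts G = A \<union> B \<and> A \<inter> B = {} \<and>
     (\<forall>(v, w) \<in> parcs G. (v \<in> A \<and> w \<in> B) \<or> (v \<in> B \<and> w \<in> A)))"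

definition forbidden_family :: "'a pair_pre_digraph set \<Rightarrow> bool" where
  "forbidden_family F \<longleftrightarrow> (\<forall>X \<in> F. pair_graph X \<and> connected (with_proj X) \<and> bipartite X \<and>
     card (pverts X) \<ge> 3)"

text \<open>A colouring is a total function, of which only the values on the vertices of the graph matter.\<close>

definition colouring :: "'b pair_pre_digraph \<Rightarrow> ('b \<Rightarrow> int) \<Rightarrow> bool" where
  "colouring G c \<longleftrightarrow> (\<forall>(v, w) \<in> parcs G. c v \<noteq> c w)"

text \<open>
  The two vertex types differ, as the members of \<open>F\<close> are compared with the subgraphs of \<open>G\<close>
  only up to isomorphism. Subgraphs are not required to be induced.
\<close>

definition free_colouring ::
  "'a pair_pre_digraph set \<Rightarrow> 'b pair_pre_digraph \<Rightarrow> ('b \<Rightarrow> int) \<Rightarrow> bool" where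
  "free_colouring F G c \<longleftrightarrow> colouring G c \<and>
     (\<forall>H. pair_graph H \<and> subgraph (with_proj H) (with_proj G) \<and>
          (\<exists>X \<in> F. digraph_iso (with_proj H) (with_proj X))
        \<longrightarrow> card (c ` pverts H) \<ge> 3)"

text \<open>
  For a finite graph and a forbidden family the minimum exists: an injective colouring is free,
  because the members of the family have at least three vertices.
\<close>

definition free_chromatic_number :: "'b pair_pre_digraph \<Rightarrow> 'a pair_pre_digraph set \<Rightarrow> nat" where
  "free_chromatic_number G F =
     (LEAST k. \<exists>c. free_colouring F G c \<and> card (c ` pverts G) \<le> k)"

text \<open>The vertices \<open>(v\<^sub>1, \<dots>, v\<^sub>d)\<close> of the product are extensional functions on \<open>{1..d}\<close>.\<close>

definition cartesian_product ::
  "nat \<Rightarrow> (nat \<Rightarrow> 'b pair_pre_digraph) \<Rightarrow> (nat \<Rightarrow> 'b) pair_pre_digraph" where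
  "cartesian_product d G =
     (let V = (\<Pi>\<^sub>E i\<in>{1..d}. pverts (G i)) in
      \<lparr> pverts = V,
        parcs = {(v, w). v \<in> V \<and> w \<in> V \<and>
          (\<exists>i\<in>{1..d}. (v i, w i) \<in> parcs (G i) \<and> (\<forall>j\<in>{1..d} - {i}. v j = w j))} \<rparr>)"

end

theory Submission
  imports Defs
begin

text \<open>
  Choose free colourings \<open>c\<^sub>i\<close> of the factors with values in \<open>{0..k}\<close> and colour a vertex \<open>v\<close> of the
  product with \<open>(\<Sum>i. s\<^sub>i c\<^sub>i(v\<^sub>i)) mod N\<close>. If \<open>s\<^sub>i x \<equiv> s\<^sub>j y\<close> modulo \<open>N\<close> with \<open>\<bar>x\<bar>, \<bar>y\<bar> \<le> k\<close> not both zero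
  forces \<open>i = j\<close> and \<open>x = y\<close>, then a connected bichromatic subgraph lies in a single copy of one factor,
  where \<open>c\<^sub>i\<close> shows that it is not a forbidden graph. So \<open>N\<close> colours suffice.

  The numbers \<open>1, k + 1, \<dots>, k(d - 1) + 1\<close> and \<open>N = 2k(kd - k + 1) + 1\<close> give the first bound. For the
  second bound the numbers are chosen modulo \<open>N\<close>, which is much denser than an integer sequence and
  avoids Mertens' theorem: if \<open>M \<ge> d\<close> is coprime to \<open>k!\<close> then \<open>N = (2k + 1)M\<close> and the residues
  \<open>1\<close> modulo \<open>2k + 1\<close> work, so \<open>(2k + 1)d + O(1)\<close> colours suffice. As \<open>2k + 1 < 2 e\<^sup>\<gamma> k log k\<close> for \<open>k \<ge> 3\<close>,
  only \<open>k = 2\<close> remains, where \<open>25d/6 + O(1)\<close> colours are obtained from \<open>N = 25M\<close> with \<open>M\<close> odd.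
\<close>

section \<open>Graphs represented by pairs\<close>

text \<open>Tails and heads are the projections of pairs on both sides, so the arc map of an
  isomorphism is determined by its vertex map.\<close>

lemma digraph_iso_with_proj_iff:
  assumes "pair_wf_digraph H"
  shows "digraph_iso (with_proj H) (with_proj X) \<longleftrightarrow>
    (\<exists>g. inj_on g (pverts H) \<and> pverts X = g ` pverts H \<and> parcs X = map_prod g g ` parcs H)"
    (is "?L \<longleftrightarrow> ?R")
proof
  interpret H: pair_wf_digraph H by fact
  {
    assume ?L
    then obtain f where f: "pre_digraph.digraph_isomorphism (with_proj H) f"
      and X: "with_proj X = app_iso f (with_proj H)"
      by (auto simp: digraph_iso_def)
    have verts: "pverts X = iso_verts f ` pverts H" and arcs: "parcs X = iso_arcs f ` parcs H"
      and "iso_tail f = fst" "iso_head f = snd"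
      using arg_cong[OF X, of verts] arg_cong[OF X, of arcs] arg_cong[OF X, of tail]
        arg_cong[OF X, of head] by auto
    then have "iso_arcs f a = map_prod (iso_verts f) (iso_verts f) a" if "a \<in> parcs H" for a
      using f that by (auto simp: pre_digraph.digraph_isomorphism_def prod_eq_iff)
    then have "parcs X = map_prod (iso_verts f) (iso_verts f) ` parcs H"
      unfolding arcs by (rule image_cong[OF refl])
    moreover have "inj_on (iso_verts f) (pverts H)"
      using f by (simp add: pre_digraph.digraph_isomorphism_def)
    ultimately show ?R using verts by blast
  }
  {
    assume ?R
    then obtain g where g: "inj_on g (pverts H)" "pverts X = g ` pverts H"
      "parcs X = map_prod g g ` parcs H" by blast
    define f where "f = \<lparr>iso_verts = g, iso_arcs = map_prod g g, iso_head = snd, iso_tail = fst\<rparr>"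
    have "parcs H \<subseteq> pverts H \<times> pverts H"
      by (auto dest: H.in_arcsD1 H.in_arcsD2)
    then have "inj_on (map_prod g g) (parcs H)"
      using map_prod_inj_on[OF g(1) g(1)] by (rule inj_on_subset[rotated])
    then have "pre_digraph.digraph_isomorphism (with_proj H) f"
      using g(1) assms unfolding pre_digraph.digraph_isomorphism_def
      by (auto simp: f_def wf_digraph_wp_iff)
    moreover have "with_proj X = app_iso f (with_proj H)"
      using g by (simp add: f_def app_iso_def with_proj_def)
    ultimately show ?L unfolding digraph_iso_def by blast
  }
qed

lemma pair_graph_image:
  assumes "pair_graph H" "inj_on g (pverts H)"
  shows "pair_graph \<lparr>pverts = g ` pverts H, parcs = map_prod g g ` parcs H\<rparr>"
proof -
  interpret H: pair_graph H by fact
  let ?K = "\<lparr>pverts = g ` pverts H, parcs = map_prod g g ` parcs H\<rparr>"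
  show ?thesis
  proof unfold_locales
    show "fst e \<in> pverts ?K" "snd e \<in> pverts ?K" if "e \<in> parcs ?K" for e
      using that by (auto dest: H.in_arcsD1 H.in_arcsD2)
    show "finite (pverts ?K)" "finite (parcs ?K)"
      by (simp_all add: H.pair_finite_verts H.pair_finite_arcs)
    show "fst e \<noteq> snd e" if "e \<in> parcs ?K" for e
      using that inj_onD[OF assms(2)] H.in_arcsD1 H.in_arcsD2 H.pair_no_loops by fastforce
    show "symmetric (with_proj ?K)"
      using H.arcs_symmetric by (force simp: symmetric_def intro!: symI)
  qed
qed

lemma digraph_iso_image:
  assumes "pair_wf_digraph H" "inj_on g (pverts H)"
  shows "digraph_iso (with_proj H)
    (with_proj \<lparr>pverts = g ` pverts H, parcs = map_prod g g ` parcs H\<rparr>)"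
  using assms by (auto simp: digraph_iso_with_proj_iff)

text \<open>Connectedness and the number of vertices carry over along the isomorphism. As
  \<open>H\<close> is symmetric, connectedness becomes directed reachability, which permits
  induction along paths.\<close>

lemma forbidden_family_copyD:
  assumes "forbidden_family F" "X \<in> F" "pair_graph H" "digraph_iso (with_proj H) (with_proj X)"
  shows "strongly_connected (with_proj H)" "card (pverts H) \<ge> 3"
proof -
  interpret H: pair_graph H by fact
  have X: "pair_graph X" "connected (with_proj X)" "card (pverts X) \<ge> 3"
    using assms(1,2) by (auto simp: forbidden_family_def)
  interpret X: pair_graph X by fact
  obtain f where "pre_digraph.digraph_isomorphism (with_proj X) f"
      "with_proj H = app_iso f (with_proj X)"
    using digraph_iso_swap[OF H.wf_digraph assms(4)] by (auto simp: digraph_iso_def)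
  then have "connected (with_proj H)"
    using X.connectedI_app_iso[OF X(2)] by metis
  then show "strongly_connected (with_proj H)"
    using H.symmetric_connected_imp_strongly_connected H.pair_sym_arcs by simp
  obtain g where "inj_on g (pverts H)" "pverts X = g ` pverts H"
    using assms(4) H.pair_wf_digraph by (auto simp: digraph_iso_with_proj_iff)
  with X(3) show "card (pverts H) \<ge> 3" by (simp add: card_image)
qed

section \<open>Free colourings\<close>

lemma free_chromatic_number_le:
  assumes "free_colouring F G c" "card (c ` pverts G) \<le> n"
  shows "free_chromatic_number G F \<le> n"
  unfolding free_chromatic_number_def using assms by (intro Least_le) blast

text \<open>An injective renaming preserves the number of colours on every set of vertices. This
  serves to normalise the palette to \<open>{0..int k}\<close>.\<close>

lemma free_colouring_comp_inj:
  assumes G: "pair_wf_digraph G" and c: "free_colouring F G c" and h: "inj_on h (c ` pverts G)"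
  shows "free_colouring F G (\<lambda>v. h (c v))"
  unfolding free_colouring_def
proof (intro conjI allI impI)
  interpret G: pair_wf_digraph G by fact
  show "colouring G (\<lambda>v. h (c v))"
    using c h G.in_arcsD1 G.in_arcsD2
    by (fastforce simp: free_colouring_def colouring_def inj_on_def)
next
  fix H
  assume H: "pair_graph H \<and> subgraph (with_proj H) (with_proj G) \<and>
    (\<exists>X\<in>F. digraph_iso (with_proj H) (with_proj X))"
  then have "c ` pverts H \<subseteq> c ` pverts G"
    by (auto simp: subgraph_def)
  then have "inj_on h (c ` pverts H)"
    using h inj_on_subset by blast
  then have "card (h ` c ` pverts H) = card (c ` pverts H)"
    by (rule card_image)
  then show "3 \<le> card ((\<lambda>v. h (c v)) ` pverts H)"
    using c H by (auto simp: free_colouring_def image_image)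
qed

lemma free_colouring_inj:
  assumes F: "forbidden_family F" and G: "pair_graph G" and c: "inj_on c (pverts G)"
  shows "free_colouring F G c"
  unfolding free_colouring_def
proof (intro conjI allI impI)
  interpret G: pair_graph G by fact
  show "colouring G c"
    using inj_onD[OF c] G.in_arcsD1 G.in_arcsD2 G.pair_no_loops
    unfolding colouring_def by auto blast
next
  fix H
  assume H: "pair_graph H \<and> subgraph (with_proj H) (with_proj G) \<and>
    (\<exists>X\<in>F. digraph_iso (with_proj H) (with_proj X))"
  then have "inj_on c (pverts H)"
    using c by (auto simp: subgraph_def intro: inj_on_subset)
  then show "3 \<le> card (c ` pverts H)"
    using forbidden_family_copyD(2)[OF F] H by (auto simp: card_image)
qed

text \<open>Injective colourings are free, hence the minimum is attained; its at most
  \<open>k + 1\<close> colours are then renamed injectively into \<open>{0..int k}\<close>.\<close>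

lemma obtain_free_colouring:
  assumes F: "forbidden_family F" and G: "pair_graph G"
    and le: "free_chromatic_number G F \<le> k + 1"
  obtains c where "free_colouring F G c" "c ` pverts G \<subseteq> {0..int k}"
proof -
  interpret G: pair_graph G by fact
  obtain c0 :: "_ \<Rightarrow> nat" where "inj_on c0 (pverts G)"
    using finite_imp_inj_to_nat_seg[OF G.pair_finite_verts] by blast
  then have "inj_on (\<lambda>v. int (c0 v)) (pverts G)"
    by (auto simp: inj_on_def)
  then have ex: "\<exists>c. free_colouring F G c \<and> card (c ` pverts G) \<le> card ((\<lambda>v. int (c0 v)) ` pverts G)"
    using free_colouring_inj[OF F G] by blast
  obtain c where c: "free_colouring F G c" "card (c ` pverts G) \<le> free_chromatic_number G F"
    using LeastI[of "\<lambda>k. \<exists>c. free_colouring F G c \<and> card (c ` pverts G) \<le> k", OF ex]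
    unfolding free_chromatic_number_def by blast
  have "card (c ` pverts G) \<le> card {0..int k}"
    using c(2) le by simp
  then obtain h where h: "inj_on h (c ` pverts G)" "h ` c ` pverts G \<subseteq> {0..int k}"
    using card_le_inj[of "c ` pverts G" "{0..int k}"] G.pair_finite_verts by auto
  show ?thesis
  proof (rule that)
    show "free_colouring F G (\<lambda>v. h (c v))"
      using free_colouring_comp_inj[OF G.pair_wf_digraph c(1) h(1)] .
    show "(\<lambda>v. h (c v)) ` pverts G \<subseteq> {0..int k}"
      using h(2) by (simp add: image_image)
  qed
qed

section \<open>Colouring the cartesian product\<close>

text \<open>
  Modular form of the \<open>k\<close>-multiplicative Sidon sets, allowing multipliers of both signs.
  The case \<open>i = j\<close> says that the products \<open>s i * x\<close> with \<open>\<bar>x\<bar> \<le> k\<close> are distinct modulo \<open>N\<close>.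
\<close>
definition sidon_modulo :: "int \<Rightarrow> int \<Rightarrow> 'i set \<Rightarrow> ('i \<Rightarrow> int) \<Rightarrow> bool" where
  "sidon_modulo N k I s \<longleftrightarrow> (\<forall>i\<in>I. \<forall>j\<in>I. \<forall>x y. \<bar>x\<bar> \<le> k \<and> \<bar>y\<bar> \<le> k \<and> N dvd s i * x - s j * y \<longrightarrow>
     x = 0 \<and> y = 0 \<or> i = j \<and> x = y)"

lemma sidon_moduloD:
  assumes "sidon_modulo N k I s" "i \<in> I" "j \<in> I" "\<bar>x\<bar> \<le> k" "\<bar>y\<bar> \<le> k" "N dvd s i * x - s j * y"
  shows "x = 0 \<and> y = 0 \<or> i = j \<and> x = y"
  using assms unfolding sidon_modulo_def by blast

text \<open>Vertices are extensional, so they agree outside \<open>{1..d}\<close> anyway and the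
  condition on the other coordinates may range over all \<open>j\<close>.\<close>

lemma cartesian_product_arcs:
  "(u, v) \<in> parcs (cartesian_product d G) \<longleftrightarrow>
     u \<in> pverts (cartesian_product d G) \<and> v \<in> pverts (cartesian_product d G) \<and>
     (\<exists>i\<in>{1..d}. (u i, v i) \<in> parcs (G i) \<and> (\<forall>j. j \<noteq> i \<longrightarrow> u j = v j))"
proof -
  have *: "(\<forall>j. j \<noteq> i \<longrightarrow> u j = v j) \<longleftrightarrow> (\<forall>j\<in>{1..d} - {i}. u j = v j)"
    if "u \<in> (\<Pi>\<^sub>E i\<in>{1..d}. pverts (G i))" "v \<in> (\<Pi>\<^sub>E i\<in>{1..d}. pverts (G i))" for i
    using PiE_arb[OF that(1)] PiE_arb[OF that(2)] by (metis Diff_iff singletonD singletonI)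
  show ?thesis
    unfolding cartesian_product_def Let_def
    by (simp only: pair_pre_digraph.simps mem_Collect_eq prod.case) (simp only: * cong: conj_cong)
qed

lemma cartesian_product_vertD:
  "v \<in> pverts (cartesian_product d G) \<Longrightarrow> i \<in> {1..d} \<Longrightarrow> v i \<in> pverts (G i)"
  by (auto simp: cartesian_product_def Let_def)

section \<open>The weighted-sum colouring and its bichromatic subgraphs\<close>

locale sidon_product =
  fixes d :: nat and G :: "nat \<Rightarrow> 'b pair_pre_digraph" and c :: "nat \<Rightarrow> 'b \<Rightarrow> int"
    and s :: "nat \<Rightarrow> int" and N k :: int
  assumes graphs: "i \<in> {1..d} \<Longrightarrow> pair_graph (G i)"
    and proper: "i \<in> {1..d} \<Longrightarrow> colouring (G i) (c i)"
    and colours: "i \<in> {1..d} \<Longrightarrow> c i ` pverts (G i) \<subseteq> {0..k}"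
    and sidon: "sidon_modulo N k {1..d} s"
begin

definition colour :: "(nat \<Rightarrow> 'b) \<Rightarrow> int" where
  "colour v = (\<Sum>i\<in>{1..d}. s i * c i (v i)) mod N"

lemma colour_eqD:
  "colour u = colour v \<Longrightarrow> N dvd (\<Sum>i\<in>{1..d}. s i * (c i (u i) - c i (v i)))"
  unfolding colour_def by (simp add: mod_eq_dvd_iff sum_subtractf right_diff_distrib)

lemma sum_differences:
  assumes "I \<subseteq> {1..d}" "\<And>i. i \<notin> I \<Longrightarrow> u i = v i"
  shows "(\<Sum>i\<in>{1..d}. s i * (c i (u i) - c i (v i))) = (\<Sum>i\<in>I. s i * (c i (u i) - c i (v i)))"
  using assms by (intro sum.mono_neutral_right) auto

lemma difference_le:
  assumes "u \<in> pverts (G i)" "v \<in> pverts (G i)" "i \<in> {1..d}"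
  shows "\<bar>c i u - c i v\<bar> \<le> k"
proof -
  have "c i u \<in> {0..k}" "c i v \<in> {0..k}"
    using assms colours[of i] by blast+
  then show ?thesis by auto
qed

text \<open>The Sidon property with \<open>j = i\<close> and \<open>y = 0\<close>. The vertices may
  be non-adjacent, so within one copy of a factor \<open>colour\<close> determines
  \<open>c i\<close>.\<close>

lemma difference_in_one_coordinate:
  assumes "u \<in> pverts (cartesian_product d G)" "v \<in> pverts (cartesian_product d G)"
    and i: "i \<in> {1..d}" and eq: "\<And>j. j \<noteq> i \<Longrightarrow> u j = v j" and col: "colour u = colour v"
  shows "c i (u i) = c i (v i)"
proof -
  have le: "\<bar>c i (u i) - c i (v i)\<bar> \<le> k"
    using assms by (intro difference_le cartesian_product_vertD)
  have "N dvd s i * (c i (u i) - c i (v i)) - s i * 0"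
    using colour_eqD[OF col] sum_differences[of "{i}" u v] i eq by auto
  with sidon_moduloD[OF sidon i i le, of 0] le show ?thesis by auto
qed

lemma adjacent_colours:
  assumes "(u, v) \<in> parcs (cartesian_product d G)"
  shows "colour u \<noteq> colour v"
proof
  assume eq: "colour u = colour v"
  obtain i where "i \<in> {1..d}" "(u i, v i) \<in> parcs (G i)" "\<And>j. j \<noteq> i \<Longrightarrow> u j = v j"
    using assms unfolding cartesian_product_arcs by blast
  with difference_in_one_coordinate[OF _ _ _ _ eq, of i] assms proper[of i] show False
    unfolding cartesian_product_arcs colouring_def by fast
qed

text \<open>If the directions differed, the changes \<open>s i * ?x\<close> and
  \<open>s j * ?y\<close> would be congruent modulo \<open>N\<close>. The Sidon property then gives
  \<open>?x = 0\<close>, although \<open>c i\<close> is proper on the first edge.\<close>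

lemma turning_colours:
  assumes u: "u \<in> pverts (cartesian_product d G)" and v: "v \<in> pverts (cartesian_product d G)"
    and w: "w \<in> pverts (cartesian_product d G)"
    and i: "i \<in> {1..d}" "(u i, v i) \<in> parcs (G i)" "\<And>l. l \<noteq> i \<Longrightarrow> u l = v l"
    and j: "j \<in> {1..d}" "(v j, w j) \<in> parcs (G j)" "\<And>l. l \<noteq> j \<Longrightarrow> v l = w l"
    and eq: "colour u = colour w"
  shows "i = j"
proof (rule ccontr)
  assume "i \<noteq> j"
  let ?x = "c i (u i) - c i (v i)" and ?y = "c j (w j) - c j (v j)"
  have x: "\<bar>?x\<bar> \<le> k" and y: "\<bar>?y\<bar> \<le> k"
    using difference_le cartesian_product_vertD u v w i(1) j(1) by blast+
  have "(\<Sum>l\<in>{1..d}. s l * (c l (u l) - c l (w l))) = s i * ?x - s j * ?y"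
    using sum_differences[of "{i, j}" u w] i j \<open>i \<noteq> j\<close> by (simp add: algebra_simps)
  then have "N dvd s i * ?x - s j * ?y"
    using colour_eqD[OF eq] by simp
  then have "?x = 0"
    using sidon_moduloD[OF sidon i(1) j(1) x y] \<open>i \<noteq> j\<close> by blast
  then show False
    using proper[OF i(1)] i(2) by (auto simp: colouring_def)
qed

text \<open>
  Two consecutive edges of a bichromatic path end in vertices of equal colour, hence they point in
  the same direction. By connectedness all edges of a bichromatic subgraph do.
\<close>

lemma bichromatic_one_direction:
  assumes H: "pair_graph H" "subgraph (with_proj H) (with_proj (cartesian_product d G))"
    and conn: "strongly_connected (with_proj H)" and large: "card (pverts H) \<ge> 3"
    and bichromatic: "card (colour ` pverts H) < 3"
  obtains i where "i \<in> {1..d}"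
    "\<And>u v. (u, v) \<in> parcs H \<Longrightarrow> (u i, v i) \<in> parcs (G i)"
    "\<And>u v j. u \<in> pverts H \<Longrightarrow> v \<in> pverts H \<Longrightarrow> j \<noteq> i \<Longrightarrow> u j = v j"
proof -
  interpret H: pair_graph H by fact
  let ?dir = "\<lambda>i u v. i \<in> {1..d} \<and> (u i, v i) \<in> parcs (G i) \<and> (\<forall>j. j \<noteq> i \<longrightarrow> u j = v j)"
  have verts: "pverts H \<subseteq> pverts (cartesian_product d G)"
    and arcs: "parcs H \<subseteq> parcs (cartesian_product d G)"
    using H(2) by (auto simp: subgraph_def)
  have dir: "\<exists>i. ?dir i u v" if "(u, v) \<in> parcs H" for u v
    using that arcs cartesian_product_arcs by blast
  have same: "i = j" if "(u, v) \<in> parcs H" "(v, w) \<in> parcs H" "?dir i u v" "?dir j v w" for u v w i j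
  proof -
    have uvw: "u \<in> pverts H" "v \<in> pverts H" "w \<in> pverts H"
      using that H.in_arcsD1 H.in_arcsD2 by blast+
    have "colour u = colour w"
    proof (rule ccontr)
      assume "colour u \<noteq> colour w"
      \<comment> \<open>The two arcs already separate \<open>v\<close> from \<open>u\<close> and
        from \<open>w\<close> in colour.\<close>
      then have "card {colour u, colour v, colour w} = 3"
        using adjacent_colours that arcs by (auto simp: subset_iff)
      moreover have "card {colour u, colour v, colour w} \<le> card (colour ` pverts H)"
        using uvw H.pair_finite_verts by (intro card_mono) auto
      ultimately show False using bichromatic by simp
    qed
    then show ?thesis
      using turning_colours[of u v w i j] that uvw verts by blast
  qed
  have turn: "?dir i v w" if uvw: "(u, v) \<in> parcs H" "(v, w) \<in> parcs H" "?dir i u v" for u v w i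
  proof -
    obtain j where j: "?dir j v w" using dir[OF uvw(2)] by blast
    with same[OF uvw] have "i = j" by blast
    with j show ?thesis by blast
  qed
  \<comment> \<open>A second vertex guarantees an arc leaving \<open>a\<close>; its direction is the
    candidate for \<open>i\<close>.\<close>
  obtain a b where "a \<in> pverts H" "b \<in> pverts H" "a \<noteq> b"
    using large by (metis card_le_Suc0_iff_eq H.pair_finite_verts One_nat_def
      numeral_le_one_iff order_trans semiring_norm(70))
  then have "a \<rightarrow>\<^sup>*\<^bsub>with_proj H\<^esub> b"
    using conn by (auto simp: strongly_connected_def)
  then obtain a' where "(a, a') \<in> parcs H"
    using \<open>a \<noteq> b\<close> by (cases rule: H.converse_reachable_cases) auto
  then obtain i where i: "?dir i a a'" using dir by blast
  then interpret Gi: pair_graph "G i" using graphs by blast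
  \<comment> \<open>Induction along a path from \<open>a\<close>: all arcs leaving a reached vertex
    point in direction \<open>i\<close>, so no other coordinate ever changes.\<close>
  have reach: "(\<forall>j. j \<noteq> i \<longrightarrow> v j = a j) \<and> (\<forall>w. (v, w) \<in> parcs H \<longrightarrow> ?dir i v w)"
    if "v \<in> pverts H" for v
  proof -
    have "a \<rightarrow>\<^sup>*\<^bsub>with_proj H\<^esub> v"
      using conn that \<open>a \<in> pverts H\<close> by (auto simp: strongly_connected_def)
    then show ?thesis
    proof (induction rule: H.reachable_induct)
      case base
      \<comment> \<open>The reversed arc enters \<open>a\<close> in direction \<open>i\<close>, so
        \<open>turn\<close> applies to every arc leaving \<open>a\<close>.\<close>
      have "(a', a) \<in> parcs H" using \<open>(a, a') \<in> parcs H\<close> by (rule H.arcs_symmetric)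
      moreover have "?dir i a' a"
      proof (intro conjI allI impI)
        show "(a' i, a i) \<in> parcs (G i)" using i Gi.arcs_symmetric by blast
        show "a' j = a j" if "j \<noteq> i" for j using i that by (metis (no_types))
      qed (use i in blast)
      ultimately show ?case using turn by blast
    next
      case (step x y)
      then have "(x, y) \<in> parcs H" by simp
      moreover have "?dir i x y" using step calculation by blast
      ultimately have "\<forall>w. (y, w) \<in> parcs H \<longrightarrow> ?dir i y w"
        using turn by blast
      moreover have "\<forall>j. j \<noteq> i \<longrightarrow> y j = a j"
        using \<open>?dir i x y\<close> step.IH by metis
      ultimately show ?case by blast
    qed
  qed
  show ?thesis
  proof (rule that)
    show "i \<in> {1..d}" using i by blast
    show "(u i, v i) \<in> parcs (G i)" if "(u, v) \<in> parcs H" for u v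
      using reach that H.in_arcsD1 by blast
    show "u j = v j" if "u \<in> pverts H" "v \<in> pverts H" "j \<noteq> i" for u v j
      using reach that by metis
  qed
qed

text \<open>A bichromatic copy of a forbidden graph would project injectively to a copy in a single
  factor \<open>G i\<close>. There \<open>c i\<close> takes at least three values, and
  \<open>colour\<close> distinguishes all of them.\<close>

lemma free_colouring_colour:
  assumes F: "forbidden_family F" and c: "\<And>i. i \<in> {1..d} \<Longrightarrow> free_colouring F (G i) (c i)"
  shows "free_colouring F (cartesian_product d G) colour"
  unfolding free_colouring_def
proof (intro conjI allI impI)
  show "colouring (cartesian_product d G) colour"
    using adjacent_colours by (auto simp: colouring_def)
next
  fix H
  assume "pair_graph H \<and> subgraph (with_proj H) (with_proj (cartesian_product d G)) \<and>
    (\<exists>X\<in>F. digraph_iso (with_proj H) (with_proj X))"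
  then obtain X where H: "pair_graph H" "subgraph (with_proj H) (with_proj (cartesian_product d G))"
    and X: "X \<in> F" "digraph_iso (with_proj H) (with_proj X)" by blast
  interpret H: pair_graph H by fact
  note copy = forbidden_family_copyD[OF F X(1) H(1) X(2)]
  show "3 \<le> card (colour ` pverts H)"
  proof (rule ccontr)
    assume "\<not> 3 \<le> card (colour ` pverts H)"
    then have "card (colour ` pverts H) < 3" by simp
    then obtain i where i: "i \<in> {1..d}"
      and arcs: "\<And>u v. (u, v) \<in> parcs H \<Longrightarrow> (u i, v i) \<in> parcs (G i)"
      and agree: "\<And>u v j. u \<in> pverts H \<Longrightarrow> v \<in> pverts H \<Longrightarrow> j \<noteq> i \<Longrightarrow> u j = v j"
      using bichromatic_one_direction[OF H copy] by blast
    interpret Gi: pair_graph "G i" using graphs[OF i] .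
    let ?p = "\<lambda>v. v i"
    let ?K = "\<lparr>pverts = ?p ` pverts H, parcs = map_prod ?p ?p ` parcs H\<rparr>"
    have inj: "inj_on ?p (pverts H)"
      using agree by (intro inj_onI ext) metis
    have K: "pair_graph ?K"
      using pair_graph_image[OF H(1) inj] .
    have "digraph_iso (with_proj ?K) (with_proj H)"
      using digraph_iso_swap[OF H.wf_digraph digraph_iso_image[OF H.pair_wf_digraph inj]] .
    then have iso: "digraph_iso (with_proj ?K) (with_proj X)"
      using X(2) by (rule digraph_iso_trans)
    have verts: "pverts H \<subseteq> pverts (cartesian_product d G)"
      using H(2) by (auto simp: subgraph_def)
    have wf: "wf_digraph (with_proj ?K)"
      using K pair_graph.pair_graphD_graph graph_def digraph_def fin_digraph_def by metis
    have "?p ` pverts H \<subseteq> pverts (G i)"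
      using verts cartesian_product_vertD[OF _ i, of _ G] by blast
    then have "subgraph (with_proj ?K) (with_proj (G i))"
      unfolding subgraph_def compatible_def using arcs Gi.wf_digraph wf by auto
    then have "3 \<le> card (c i ` ?p ` pverts H)"
      using c[OF i] K iso X(1) unfolding free_colouring_def by auto
    also have "\<dots> \<le> card (colour ` pverts H)"
    proof -
      \<comment> \<open>\<open>h\<close> recovers the factor colour from the product colour through
        an arbitrary representative in \<open>H\<close>; the choice is irrelevant by
        \<open>difference_in_one_coordinate\<close>.\<close>
      define h where "h z = c i (inv_into (pverts H) colour z i)" for z
      have "h (colour v) = c i (v i)" if "v \<in> pverts H" for v
      proof -
        let ?w = "inv_into (pverts H) colour (colour v)"
        have "?w \<in> pverts H" "colour ?w = colour v"
          using that by (simp_all add: inv_into_into f_inv_into_f)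
        then show ?thesis
          unfolding h_def using difference_in_one_coordinate[of ?w v i] i agree that verts by blast
      qed
      then have "c i ` ?p ` pverts H = h ` colour ` pverts H"
        by (simp add: image_image)
      then show ?thesis
        using H.pair_finite_verts by (simp add: card_image_le)
    qed
    finally show False using \<open>\<not> 3 \<le> card (colour ` pverts H)\<close> by simp
  qed
qed

end

theorem free_chromatic_number_cartesian_product_le:
  assumes F: "forbidden_family F"
    and G: "\<And>i. i \<in> {1..d} \<Longrightarrow> pair_graph (G i) \<and> free_chromatic_number (G i) F \<le> k + 1"
    and s: "sidon_modulo (int N) (int k) {1..d} s" and "N > 0"
  shows "free_chromatic_number (cartesian_product d G) F \<le> N"
proof -
  have "\<exists>c. free_colouring F (G i) c \<and> c ` pverts (G i) \<subseteq> {0..int k}" if "i \<in> {1..d}" for i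
    using obtain_free_colouring[OF F] G[OF that] by metis
  then obtain c where c: "\<And>i. i \<in> {1..d} \<Longrightarrow> free_colouring F (G i) (c i)"
    "\<And>i. i \<in> {1..d} \<Longrightarrow> c i ` pverts (G i) \<subseteq> {0..int k}"
    by metis
  interpret sidon_product d G c s "int N" "int k"
    using G c s by (intro sidon_product.intro) (auto simp: free_colouring_def)
  have "colour ` pverts (cartesian_product d G) \<subseteq> {0..<int N}"
    using \<open>N > 0\<close> by (auto simp: colour_def)
  then have "card (colour ` pverts (cartesian_product d G)) \<le> card {0..<int N}"
    by (intro card_mono) auto
  with free_colouring_colour[OF F c(1)] show ?thesis
    by (intro free_chromatic_number_le[of F _ colour]) auto
qed

section \<open>Modular Sidon sequences\<close>

lemma sidon_modulo_mono:
  "sidon_modulo N k J s \<Longrightarrow> I \<subseteq> J \<Longrightarrow> sidon_modulo N k I s"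
  unfolding sidon_modulo_def by blast

lemma eq_if_dvd_diff:
  fixes a b m :: int
  assumes "m dvd a - b" "\<bar>a - b\<bar> < m"
  shows "a = b"
  using assms zdvd_imp_le[of m "\<bar>a - b\<bar>"] by fastforce

text \<open>All products have absolute value at most \<open>k * M\<close>, where \<open>M\<close>
  bounds the multipliers, and the modulus is \<open>2 * k * M + 1\<close>, so congruence is
  equality. The multipliers are positive and 1 modulo \<open>k\<close>, so \<open>x\<close> and
  \<open>y\<close> agree in sign and modulo \<open>k\<close>.\<close>

lemma sidon_modulo_one_mod:
  fixes k d :: nat
  assumes k: "k \<ge> 1"
  shows "sidon_modulo (int (2 * k * (k * d - k + 1) + 1)) (int k) {1..d}
    (\<lambda>i. int k * (int i - 1) + 1)" (is "sidon_modulo ?N _ _ ?s")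
  unfolding sidon_modulo_def
proof (intro ballI allI impI)
  fix i j x y
  assume i: "i \<in> {1..d}" and j: "j \<in> {1..d}"
    and "\<bar>x\<bar> \<le> int k \<and> \<bar>y\<bar> \<le> int k \<and> ?N dvd ?s i * x - ?s j * y"
  then have x: "\<bar>x\<bar> \<le> int k" and y: "\<bar>y\<bar> \<le> int k" and dvd: "?N dvd ?s i * x - ?s j * y" by auto
  define M where "M = int k * (int d - 1) + 1"
  \<comment> \<open>The index \<open>i\<close> witnesses \<open>d \<ge> 1\<close>, so the natural
    subtraction is not truncated.\<close>
  have "k \<le> k * d" using i by (cases d) auto
  then have "int (k * d - k + 1) = M"
    by (simp add: M_def of_nat_diff algebra_simps)
  then have N: "?N = 2 * int k * M + 1"
    by (metis of_nat_1 of_nat_add of_nat_mult of_nat_numeral)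
  have s: "1 \<le> ?s l" "?s l \<le> M" if "l \<in> {1..d}" for l
    using that by (auto simp: M_def intro!: mult_left_mono)
  have bound: "\<bar>?s l * z\<bar> \<le> M * int k" if "l \<in> {1..d}" "\<bar>z\<bar> \<le> int k" for l z
    unfolding abs_mult using s[OF that(1)] that(2) by (intro mult_mono) auto
  have "\<bar>?s i * x - ?s j * y\<bar> < ?N"
    using bound[OF i x] bound[OF j y] unfolding N by (simp only: mult_ac)
  then have eq: "?s i * x = ?s j * y"
    using eq_if_dvd_diff[OF dvd] by blast
  have sgn: "sgn x = sgn y"
    using arg_cong[OF eq, of sgn] s(1)[OF i] s(1)[OF j] by (simp add: sgn_mult)
  show "x = 0 \<and> y = 0 \<or> i = j \<and> x = y"
  proof (cases "x = 0")
    case True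
    then show ?thesis using sgn by (simp add: sgn_0_0)
  next
    case False
    \<comment> \<open>Both numbers are nonzero of the same sign, so their absolute values lie
      between 1 and \<open>k\<close>.\<close>
    have "\<bar>x - y\<bar> < int k"
      using False sgn x y by (auto simp: sgn_if split: if_splits)
    moreover have "x - y = int k * ((int j - 1) * y - (int i - 1) * x)"
      using eq by (simp add: algebra_simps)
    ultimately have "x = y"
      using eq_if_dvd_diff by (metis dvd_triv_left)
    then show ?thesis
      using eq False k by auto
  qed
qed

text \<open>Reduction modulo \<open>2 * k + 1\<close> gives \<open>x = y\<close>, as the difference
  is at most \<open>2 * k\<close>. What remains is that \<open>M\<close> divides
  \<open>(i - j) * x\<close>; a nonzero \<open>x\<close> is coprime to \<open>M\<close> and cancels,
  and \<open>\<bar>i - j\<bar> < M\<close>.\<close>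

lemma sidon_modulo_coprime:
  fixes k M :: nat
  assumes coprime: "\<And>x. 1 \<le> x \<Longrightarrow> x \<le> k \<Longrightarrow> coprime x M"
  shows "sidon_modulo (int ((2 * k + 1) * M)) (int k) {1..M} (\<lambda>i. (2 * int k + 1) * int i + 1)"
  unfolding sidon_modulo_def
proof (intro ballI allI impI)
  fix i j x y
  let ?q = "2 * int k + 1"
  assume i: "i \<in> {1..M}" and j: "j \<in> {1..M}"
    and "\<bar>x\<bar> \<le> int k \<and> \<bar>y\<bar> \<le> int k \<and>
      int ((2 * k + 1) * M) dvd (?q * int i + 1) * x - (?q * int j + 1) * y"
  then have x: "\<bar>x\<bar> \<le> int k" and y: "\<bar>y\<bar> \<le> int k"
    and dvd: "?q * int M dvd (?q * int i + 1) * x - (?q * int j + 1) * y"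
    by (simp_all only: of_nat_mult of_nat_add of_nat_numeral of_nat_1)
  have "(?q * int i + 1) * x - (?q * int j + 1) * y = ?q * (int i * x - int j * y) + (x - y)"
    by (simp add: algebra_simps)
  then have "?q dvd x - y"
    using dvd by (metis dvd_add_right_iff dvd_mult_left dvd_triv_left)
  then have "x = y"
    using x y by (intro eq_if_dvd_diff) auto
  then have "?q * int M dvd ?q * ((int i - int j) * x)"
    using dvd by (simp add: algebra_simps)
  then have *: "int M dvd (int i - int j) * x" by (subst (asm) dvd_mult_cancel_left) auto
  show "x = 0 \<and> y = 0 \<or> i = j \<and> x = y"
  proof (cases "x = 0")
    case False
    then have "coprime (nat \<bar>x\<bar>) M" using x by (intro coprime) auto
    then have "coprime (int (nat \<bar>x\<bar>)) (int M)" unfolding coprime_int_iff .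
    then have "coprime (int M) x" by (simp add: coprime_commute)
    then have "int M dvd int i - int j"
      using * by (simp add: coprime_dvd_mult_left_iff)
    then have "int i = int j"
      using i j by (intro eq_if_dvd_diff) auto
    then show ?thesis using \<open>x = y\<close> by simp
  qed (use \<open>x = y\<close> in simp)
qed

text \<open>
  The residues whose last nonzero digit in base 5 is 1, truncated to two digits. Their density
  exceeds the density \<open>1 / 5\<close> of the previous lemma, which for \<open>k = 2\<close> is just too small.
\<close>

lemma sidon_modulo_two:
  fixes M :: nat
  assumes "odd M"
  shows "sidon_modulo (int (25 * M)) 2 {1..6 * M}
    (\<lambda>i. if i \<le> 5 * M then 5 * int i + 1 else 25 * int i + 5)" (is "sidon_modulo _ _ _ ?s")
  unfolding sidon_modulo_def
proof (intro ballI allI impI)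
  fix i j x y
  assume i: "i \<in> {1..6 * M}" and j: "j \<in> {1..6 * M}"
    and "\<bar>x\<bar> \<le> 2 \<and> \<bar>y\<bar> \<le> 2 \<and> int (25 * M) dvd ?s i * x - ?s j * y"
  then have x: "\<bar>x\<bar> \<le> 2" and y: "\<bar>y\<bar> \<le> 2" and dvd: "25 * int M dvd ?s i * x - ?s j * y" by auto
  have small: "z = 0" if "5 dvd z" "\<bar>z\<bar> \<le> 2" for z :: int
    using eq_if_dvd_diff[of 5 z 0] that by auto
  have dvd25: "25 dvd ?s i * x - ?s j * y"
    using dvd by (rule dvd_mult_left)
  have low: "5 dvd b" if "25 dvd 5 * a + b" for a b :: int
    using that by presburger
  have high: "5 dvd b" if "25 dvd 25 * a + 5 * b" for a b :: int
    using that by presburger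
  have cancel: "int m dvd z" if "int m dvd z * x" "x \<noteq> 0" "odd m" for m z
  proof -
    have "x \<in> {-2, -1, 1, 2}" using x \<open>x \<noteq> 0\<close> by auto
    then have "coprime (int m) x" using \<open>odd m\<close> by auto
    then show ?thesis using that by (simp add: coprime_dvd_mult_left_iff)
  qed
  \<comment> \<open>The first \<open>5 * M\<close> indices give residues 1 modulo 5, the last
    \<open>M\<close> give residues 5 modulo 25. Within a block a factor 5 or 25 is removed and
    \<open>x\<close> cancels, being coprime to the odd number \<open>5 * M\<close> or
    \<open>M\<close>.\<close>
  have "x = y \<and> (x = 0 \<or> i = j)"
  proof (cases "i \<le> 5 * M"; cases "j \<le> 5 * M")
    assume le: "i \<le> 5 * M" "j \<le> 5 * M"
    have "25 dvd 5 * (int i * x - int j * y) + (x - y)"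
      using dvd25 le by (simp add: algebra_simps)
    then have "5 dvd x - y"
      by (rule low)
    then have "x = y"
      using x y by (intro eq_if_dvd_diff[of 5]) auto
    then have "5 * int (5 * M) dvd 5 * ((int i - int j) * x)"
      using dvd le by (simp add: algebra_simps)
    then have *: "int (5 * M) dvd (int i - int j) * x"
      by (subst (asm) dvd_mult_cancel_left) auto
    have "int i = int j" if "x \<noteq> 0"
      using cancel[OF * that] assms le i j by (intro eq_if_dvd_diff[of "int (5 * M)"]) auto
    then show ?thesis using \<open>x = y\<close> by auto
  next
    \<comment> \<open>In the mixed cases reduction modulo 5 kills the multiplier of the first block;
      then reduction modulo 25 kills the other.\<close>
    assume le: "i \<le> 5 * M" "\<not> j \<le> 5 * M"
    have "25 dvd 5 * (int i * x - 5 * int j * y - y) + x"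
      using dvd25 le by (simp add: algebra_simps)
    then have "x = 0" using low small x by blast
    then have "25 dvd 25 * (- int j * y) + 5 * (- y)"
      using dvd25 le by (simp add: algebra_simps)
    then have "- y = 0" using high small y by (metis abs_minus_cancel)
    with \<open>x = 0\<close> show ?thesis by simp
  next
    assume le: "\<not> i \<le> 5 * M" "j \<le> 5 * M"
    have "25 dvd 5 * (5 * int i * x + x - int j * y) + (- y)"
      using dvd25 le by (simp add: algebra_simps)
    then have "- y = 0" using low small y by (metis abs_minus_cancel)
    then have "25 dvd 25 * (int i * x) + 5 * x"
      using dvd25 le by (simp add: algebra_simps)
    then have "x = 0" using high small x by blast
    with \<open>- y = 0\<close> show ?thesis by simp
  next
    assume le: "\<not> i \<le> 5 * M" "\<not> j \<le> 5 * M"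
    have "25 dvd 25 * (int i * x - int j * y) + 5 * (x - y)"
      using dvd25 le by (simp add: algebra_simps)
    then have "5 dvd x - y"
      by (rule high)
    then have "x = y"
      using x y by (intro eq_if_dvd_diff[of 5]) auto
    then have "25 * int M dvd 25 * ((int i - int j) * x)"
      using dvd le by (simp add: algebra_simps)
    then have *: "int M dvd (int i - int j) * x"
      by (subst (asm) dvd_mult_cancel_left) auto
    have "int i = int j" if "x \<noteq> 0"
      using cancel[OF * that] assms le i j by (intro eq_if_dvd_diff[of "int M"]) auto
    then show ?thesis using \<open>x = y\<close> by auto
  qed
  then show "x = 0 \<and> y = 0 \<or> i = j \<and> x = y" by auto
qed

section \<open>Comparison with Euler's constant\<close>

text \<open>The value 17/10 leaves enough room in both comparisons below: 25/6 < 4 * (17/10) *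
  (2/3), and 2k + 2 is at most (17/5) k for \<open>k \<ge> 3\<close>.\<close>

lemma exp_euler_mascheroni_ge: "exp (euler_mascheroni :: real) \<ge> 17 / 10"
proof -
  have "(17 / 10 :: real) \<le> 1 + 19 / 33 + (19 / 33)\<^sup>2 / 2"
    by (simp add: power2_eq_square)
  also have "\<dots> \<le> exp (19 / 33)"
    by (rule exp_lower_Taylor_quadratic) simp
  also have "\<dots> \<le> exp euler_mascheroni"
    using euler_mascheroni_gt_19_over_33 by simp
  finally show ?thesis .
qed

lemma sidon_modulo_eventually:
  fixes k :: nat
  assumes "k \<ge> 2"
  shows "\<exists>D. \<forall>d>D. \<exists>N s. N > 0 \<and> sidon_modulo (int N) (int k) {1..d} s \<and>
    real N \<le> 2 * exp euler_mascheroni * real d * real k * ln (real k)"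
proof (cases "k = 2")
  case True
  have *: "\<exists>N s. N > 0 \<and> sidon_modulo (int N) 2 {1..d} s \<and>
      real N \<le> 2 * exp euler_mascheroni * real d * 2 * ln 2" if d: "d > 205" for d
  proof -
    \<comment> \<open>An odd number with \<open>6 * M = 12 * (d div 12) + 18\<close>, which is at
      least \<open>d\<close>.\<close>
    define M where "M = 2 * (d div 12) + 3"
    have "odd M" by (simp add: M_def)
    have "d \<le> 6 * M" by (simp add: M_def)
    have "sidon_modulo (int (25 * M)) 2 {1..d} (\<lambda>i. if i \<le> 5 * M then 5 * int i + 1 else 25 * int i + 5)"
      by (rule sidon_modulo_mono[OF sidon_modulo_two[OF \<open>odd M\<close>]]) (use \<open>d \<le> 6 * M\<close> in auto)
    moreover have "real (25 * M) \<le> 2 * exp euler_mascheroni * real d * 2 * ln 2"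
    proof -
      \<comment> \<open>Here \<open>25 * M\<close> is at most 25d/6 + 75. As 68/15 - 25/6 = 11/30,
        the term 75 is absorbed once \<open>d\<close> is at least 2250/11 < 205.\<close>
      have "12 * (d div 12) \<le> d" by simp
      then have "real (12 * (d div 12)) \<le> real d" by (rule of_nat_mono)
      then have "real (25 * M) \<le> 4 * (17 / 10 * (2 / 3)) * real d"
        using d by (simp add: M_def)
      also have "\<dots> \<le> 4 * (exp euler_mascheroni * ln 2) * real d"
        using exp_euler_mascheroni_ge ln2_ge_two_thirds
        by (intro mult_right_mono mult_left_mono mult_mono) auto
      finally show ?thesis by (simp add: mult_ac)
    qed
    moreover have "25 * M > 0" by (simp add: M_def)
    ultimately show ?thesis by blast
  qed
  show ?thesis unfolding True using * by (intro exI[of _ 205]) simp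
next
  case False
  then have k: "k \<ge> 3" using assms by simp
  \<comment> \<open>This bounds the excess of \<open>(2 * k + 1) * M\<close> over
    \<open>(2 * k + 1) * d\<close>, so for \<open>d > ?D\<close> one further \<open>d\<close> pays
    for it.\<close>
  let ?D = "(2 * k + 1) * (fact k + 1)"
  have "\<exists>N s. N > 0 \<and> sidon_modulo (int N) (int k) {1..d} s \<and>
      real N \<le> 2 * exp euler_mascheroni * real d * real k * ln (real k)" if d: "d > ?D" for d
  proof -
    \<comment> \<open>Being 1 modulo \<open>fact k\<close> makes \<open>M\<close> coprime to
      \<open>1, ..., k\<close>; the quotient is rounded up so that \<open>M\<close> exceeds
      \<open>d\<close> by at most \<open>fact k + 1\<close>.\<close>
    define M where "M = fact k * (d div fact k + 1) + 1"
    have coprime: "coprime x M" if "1 \<le> x" "x \<le> k" for x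
    proof -
      have "x dvd fact k" using that by (intro dvd_fact) auto
      then have "x dvd fact k * (d div fact k + 1)" by (rule dvd_mult2)
      then obtain t where "M = x * t + 1" unfolding M_def by (auto elim: dvdE)
      then show ?thesis
        by (intro coprimeI) (metis dvd_add_right_iff dvd_mult2)
    qed
    have "d = fact k * (d div fact k) + d mod fact k" by simp
    moreover have "d mod fact k < fact k" by simp
    ultimately have M: "d \<le> M" "M \<le> d + fact k + 1"
      unfolding M_def distrib_left by linarith+
    have "sidon_modulo (int ((2 * k + 1) * M)) (int k) {1..d} (\<lambda>i. (2 * int k + 1) * int i + 1)"
      by (rule sidon_modulo_mono[OF sidon_modulo_coprime[OF coprime]]) (use M(1) in auto)
    moreover have "real ((2 * k + 1) * M) \<le> 2 * exp euler_mascheroni * real d * real k * ln (real k)"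
    proof -
      have "(2 * k + 1) * M \<le> (2 * k + 1) * (d + fact k + 1)"
        using M(2) by (rule mult_le_mono2)
      also have "\<dots> = (2 * k + 1) * d + ?D" by (simp add: algebra_simps)
      also have "\<dots> \<le> (2 * k + 2) * d" using d by simp
      finally have "real ((2 * k + 1) * M) \<le> real ((2 * k + 2) * d)" by (rule of_nat_mono)
      also have "\<dots> = (2 * real k + 2) * real d" by (simp add: distrib_right)
      also have "\<dots> \<le> (2 * (17 / 10 * 1) * real k) * real d"
        using k by (intro mult_right_mono) auto
      also have "\<dots> \<le> (2 * (exp euler_mascheroni * ln (real k)) * real k) * real d"
      proof -
        \<comment> \<open>Here \<open>k \<ge> 3\<close> enters, through e < 3.\<close>
        have "exp 1 \<le> real k" using exp_le k by linarith
        then have "1 \<le> ln (real k)" using k by (simp add: ln_ge_iff)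
        then show ?thesis
          using exp_euler_mascheroni_ge by (intro mult_right_mono mult_left_mono mult_mono) auto
      qed
      finally show ?thesis by (simp add: mult_ac)
    qed
    moreover have "(2 * k + 1) * M > 0" by (simp add: M_def)
    ultimately show ?thesis by blast
  qed
  then show ?thesis by blast
qed

section \<open>The two bounds on the chromatic number of the product\<close>

theorem theorem1:
  shows
    "(\<forall>(F :: 'a pair_pre_digraph set) (k :: nat) (d :: nat) (G :: nat \<Rightarrow> 'b pair_pre_digraph).
        forbidden_family F \<and> k \<ge> 1 \<and> d \<ge> 1 \<and>
        (\<forall>i\<in>{1..d}. pair_graph (G i) \<and> free_chromatic_number (G i) F \<le> k + 1)
        \<longrightarrow> free_chromatic_number (cartesian_product d G) F \<le> 2 * k * (k * d - k + 1) + 1)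
     \<and>
     (\<forall>(k :: nat) (\<epsilon> :: real). k \<ge> 2 \<and> 0 < \<epsilon> \<and> \<epsilon> < 1 \<longrightarrow>
        (\<exists>D :: nat. \<forall>d > D. \<forall>(F :: 'a pair_pre_digraph set) (G :: nat \<Rightarrow> 'b pair_pre_digraph).
           forbidden_family F \<and>
           (\<forall>i\<in>{1..d}. pair_graph (G i) \<and> free_chromatic_number (G i) F \<le> k + 1)
           \<longrightarrow> real (free_chromatic_number (cartesian_product d G) F)
                 \<le> 1 + 2 * exp euler_mascheroni / (1 - \<epsilon>) * real d * real k * ln (real k)))"
proof (intro conjI allI impI)
  fix F :: "'a pair_pre_digraph set" and k d :: nat and G :: "nat \<Rightarrow> 'b pair_pre_digraph"
  assume "forbidden_family F \<and> k \<ge> 1 \<and> d \<ge> 1 \<and>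
    (\<forall>i\<in>{1..d}. pair_graph (G i) \<and> free_chromatic_number (G i) F \<le> k + 1)"
  then show "free_chromatic_number (cartesian_product d G) F \<le> 2 * k * (k * d - k + 1) + 1"
    by (intro free_chromatic_number_cartesian_product_le[OF _ _ sidon_modulo_one_mod]) auto
next
  fix k :: nat and \<epsilon> :: real
  assume k: "k \<ge> 2 \<and> 0 < \<epsilon> \<and> \<epsilon> < 1"
  let ?B = "\<lambda>d. 2 * exp euler_mascheroni * real d * real k * ln (real k)"
  have B: "?B d \<le> 1 + 2 * exp euler_mascheroni / (1 - \<epsilon>) * real d * real k * ln (real k)" for d
  proof -
    have "?B d * (1 - \<epsilon>) \<le> ?B d * 1"
      using k by (intro mult_left_mono) auto
    then have "?B d \<le> ?B d / (1 - \<epsilon>)"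
      using k by (simp add: pos_le_divide_eq)
    then show ?thesis by simp
  qed
  \<comment> \<open>The threshold comes from a statement about integers alone, hence it is uniform
    in the family and the factors.\<close>
  obtain D where D: "\<And>d. d > D \<Longrightarrow>
      \<exists>N s. N > 0 \<and> sidon_modulo (int N) (int k) {1..d} s \<and> real N \<le> ?B d"
    using sidon_modulo_eventually[of k] k by blast
  show "\<exists>D. \<forall>d>D. \<forall>(F :: 'a pair_pre_digraph set) (G :: nat \<Rightarrow> 'b pair_pre_digraph).
      forbidden_family F \<and>
      (\<forall>i\<in>{1..d}. pair_graph (G i) \<and> free_chromatic_number (G i) F \<le> k + 1) \<longrightarrow>
      real (free_chromatic_number (cartesian_product d G) F)
        \<le> 1 + 2 * exp euler_mascheroni / (1 - \<epsilon>) * real d * real k * ln (real k)"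
  proof (intro exI[of _ D] allI impI)
    fix d and F :: "'a pair_pre_digraph set" and G :: "nat \<Rightarrow> 'b pair_pre_digraph"
    assume "d > D" and FG: "forbidden_family F \<and>
      (\<forall>i\<in>{1..d}. pair_graph (G i) \<and> free_chromatic_number (G i) F \<le> k + 1)"
    obtain N s where N: "N > 0" "sidon_modulo (int N) (int k) {1..d} s" "real N \<le> ?B d"
      using D[OF \<open>d > D\<close>] by blast
    have "free_chromatic_number (cartesian_product d G) F \<le> N"
      using FG N by (intro free_chromatic_number_cartesian_product_le) auto
    then show "real (free_chromatic_number (cartesian_product d G) F)
        \<le> 1 + 2 * exp euler_mascheroni / (1 - \<epsilon>) * real d * real k * ln (real k)"
      using N(3) B[of d] by linarith
  qed
qed

end
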